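(* If $X$ is path connected, locally path connected, and semilocally 1-connected, then $\mathbf{Cov}(X)=\mathbf{SCov}(X)$ and $\mathbf{Cov_0}(X)=\mathbf{SCov_0}(X)$.
   Context: Conventions: "map" means continuous function; $I=[0,1]$; mapping spaces carry the compact-open topology. $\mathcal{P}X$ is the space of paths $I\to X$; $(\mathcal{P}X)_x$ is the subspace of paths starting at $x$. $X$ is semilocally 1-connected if each $x\in X$ has a neighborhood $U$ such that $\pi_1(U,x)\to\pi_1(X,x)$ is trivial. Let $\Delta_2=\{(s,t)\in I^2: s+t\le 1\}$, $e_1=\{(0,t): t\in I\}$, and let $(\Phi X)_x$ be the space of maps $\phi\colon\Delta_2\to X$ with $\phi(e_1)=\{x\}$. A map $p\colon Y\to X$ has continuous lifting of paths (resp. homotopies) if for each $y\in Y$ the map $(\mathcal{P}Y)_y\to(\mathcal{P}X)_{p(y)}$, $\alpha\mapsto p\circ\alpha$ (resp. $(\Phi Y)_y\to(\Phi X)_{p(y)}$, $\phi\mapsto p\circ\phi$) is a homeomorphism. A semicovering map is a local homeomorphism with continuous lifting of paths and homotopies (the empty map $\emptyset\to X$ is allowed). $\mathbf{SCov}(X)$ is the category of semicoverings of $X$; a morphism from $p\colon Y\to X$ to $p'\colon Y'\to X$ is a map $f\colon Y\to Y'$ with $p'\circ f=p$. $\mathbf{Cov}(X)$ is the category of covering maps $p\colon Y\to X$ (fibers allowed to be empty) with the same notion of morphism. $\mathbf{SCov_0}(X)$ and $\mathbf{Cov_0}(X)$ are the full subcategories of those $p\colon Y\to X$ with $Y$ non-empty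 and path connected. *)

theory Defs
  imports "HOL-Analysis.Analysis" "HOL-Algebra.Group"
begin

section \<open>Mapping spaces\<close>

text \<open>A map with domain \<open>K\<close> is represented by the HOL function that is \<open>undefined\<close>
  outside \<open>topspace K\<close>, so that equality of maps is equality in HOL. Taking
  \<open>C = {}\<close> shows that the subbasis below covers the set of all maps.\<close>

definition maps :: "'k topology \<Rightarrow> 'a topology \<Rightarrow> ('k \<Rightarrow> 'a) set" where
  "maps K X = {f \<in> extensional (topspace K). continuous_map K X f}"

definition compact_open :: "'k topology \<Rightarrow> 'a topology \<Rightarrow> ('k \<Rightarrow> 'a) topology" where
  "compact_open K X = topology_generated_by
     {{f \<in> maps K X. f ` C \<subseteq> U} | C U. compactin K C \<and> openin X U}"

lemma topspace_compact_open [simp]: "topspace (compact_open K X) = maps K X"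
proof -
  have "maps K X = {f \<in> maps K X. f ` {} \<subseteq> {}}"
    by simp
  then have "maps K X \<in> {{f \<in> maps K X. f ` C \<subseteq> U} | C U. compactin K C \<and> openin X U}"
    using compactin_empty openin_empty by blast
  then show ?thesis
    unfolding compact_open_def topology_generated_by_topspace by blast
qed

definition paths_from :: "'a topology \<Rightarrow> 'a \<Rightarrow> (real \<Rightarrow> 'a) topology" where
  "paths_from X x = subtopology (compact_open (top_of_set {0..1}) X) {\<alpha>. \<alpha> 0 = x}"

definition Delta2 :: "(real \<times> real) set" where
  "Delta2 = {(s, t). s \<in> {0..1} \<and> t \<in> {0..1} \<and> s + t \<le> 1}"

definition edge1 :: "(real \<times> real) set" where
  "edge1 = {(0, t) | t. t \<in> {0..1}}"

definition triangles_from :: "'a topology \<Rightarrow> 'a \<Rightarrow> (real \<times> real \<Rightarrow> 'a) topology" where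
  "triangles_from X x =
     subtopology (compact_open (top_of_set Delta2) X) {\<phi>. \<phi> ` edge1 = {x}}"


section \<open>Semicovering maps and covering maps\<close>

definition continuous_lifting_of_paths ::
    "'b topology \<Rightarrow> 'a topology \<Rightarrow> ('b \<Rightarrow> 'a) \<Rightarrow> bool" where
  "continuous_lifting_of_paths Y X p \<longleftrightarrow>
     (\<forall>y \<in> topspace Y.
        homeomorphic_map (paths_from Y y) (paths_from X (p y)) (compose {0..1} p))"

definition continuous_lifting_of_homotopies ::
    "'b topology \<Rightarrow> 'a topology \<Rightarrow> ('b \<Rightarrow> 'a) \<Rightarrow> bool" where
  "continuous_lifting_of_homotopies Y X p \<longleftrightarrow>
     (\<forall>y \<in> topspace Y.
        homeomorphic_map (triangles_from Y y) (triangles_from X (p y)) (compose Delta2 p))"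

definition local_homeomorphism :: "'b topology \<Rightarrow> 'a topology \<Rightarrow> ('b \<Rightarrow> 'a) \<Rightarrow> bool" where
  "local_homeomorphism Y X p \<longleftrightarrow>
     continuous_map Y X p \<and>
     (\<forall>y \<in> topspace Y. \<exists>V. openin Y V \<and> y \<in> V \<and> openin X (p ` V) \<and>
        homeomorphic_map (subtopology Y V) (subtopology X (p ` V)) p)"

definition semicovering_map :: "'b topology \<Rightarrow> 'a topology \<Rightarrow> ('b \<Rightarrow> 'a) \<Rightarrow> bool" where
  "semicovering_map Y X p \<longleftrightarrow>
     local_homeomorphism Y X p \<and>
     continuous_lifting_of_paths Y X p \<and>
     continuous_lifting_of_homotopies Y X p"

text \<open>The library's \<open>covering_space\<close> requires surjectivity; here the family \<open>\<V>\<close>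
  of sheets over \<open>U\<close> may be empty.\<close>

definition covering_map :: "'b topology \<Rightarrow> 'a topology \<Rightarrow> ('b \<Rightarrow> 'a) \<Rightarrow> bool" where
  "covering_map Y X p \<longleftrightarrow>
     continuous_map Y X p \<and>
     (\<forall>x \<in> topspace X. \<exists>U. openin X U \<and> x \<in> U \<and>
        (\<exists>\<V>. \<Union>\<V> = {y \<in> topspace Y. p y \<in> U} \<and>
             (\<forall>V \<in> \<V>. openin Y V) \<and>
             pairwise disjnt \<V> \<and>
             (\<forall>V \<in> \<V>. homeomorphic_map (subtopology Y V) (subtopology X U) p)))"


section \<open>The fundamental group\<close>

text \<open>Loops are not required to be \<open>undefined\<close> outside the unit interval: functions that
  agree on it are path homotopic, so this choice does not affect the quotient.\<close>

definition loops :: "'a topology \<Rightarrow> 'a \<Rightarrow> (real \<Rightarrow> 'a) set" where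
  "loops X x = {g. pathin X g \<and> g 0 = x \<and> g 1 = x}"

definition path_homotopic :: "'a topology \<Rightarrow> (real \<Rightarrow> 'a) \<Rightarrow> (real \<Rightarrow> 'a) \<Rightarrow> bool" where
  "path_homotopic X g h \<longleftrightarrow>
     homotopic_with (\<lambda>r. r 0 = g 0 \<and> r 1 = g 1) (top_of_set {0..1}) X g h"

definition loop_homotopy :: "'a topology \<Rightarrow> 'a \<Rightarrow> ((real \<Rightarrow> 'a) \<times> (real \<Rightarrow> 'a)) set" where
  "loop_homotopy X x = {(g, h). g \<in> loops X x \<and> h \<in> loops X x \<and> path_homotopic X g h}"

definition concat_path :: "(real \<Rightarrow> 'a) \<Rightarrow> (real \<Rightarrow> 'a) \<Rightarrow> real \<Rightarrow> 'a" where
  "concat_path g h = (\<lambda>t. if t \<le> 1/2 then g (2 * t) else h (2 * t - 1))"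

definition pi1 :: "'a topology \<Rightarrow> 'a \<Rightarrow> (real \<Rightarrow> 'a) set monoid" where
  "pi1 X x =
     \<lparr>carrier = loops X x // loop_homotopy X x,
      monoid.mult = (\<lambda>A B. loop_homotopy X x `` {concat_path g h | g h. g \<in> A \<and> h \<in> B}),
      one = loop_homotopy X x `` {\<lambda>t. x}\<rparr>"

text \<open>\<open>pi1_map X x f\<close> is the homomorphism into \<open>pi1 X x\<close> induced by a map \<open>f\<close>
  into \<open>X\<close> which sends the base point to \<open>x\<close>.\<close>

definition pi1_map ::
    "'a topology \<Rightarrow> 'a \<Rightarrow> ('c \<Rightarrow> 'a) \<Rightarrow> (real \<Rightarrow> 'c) set \<Rightarrow> (real \<Rightarrow> 'a) set" where
  "pi1_map X x f A = loop_homotopy X x `` {f \<circ> g | g. g \<in> A}"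

text \<open>The neighborhood \<open>U\<close> of \<open>x\<close> need not be open, and the map
  \<open>\<lambda>u. u\<close> is the inclusion of \<open>U\<close> into \<open>X\<close>.\<close>

definition semilocally_1_connected :: "'a topology \<Rightarrow> bool" where
  "semilocally_1_connected X \<longleftrightarrow>
     (\<forall>x \<in> topspace X. \<exists>U \<subseteq> topspace X. x \<in> X interior_of U \<and>
        (\<forall>A \<in> carrier (pi1 (subtopology X U) x). pi1_map X x (\<lambda>u. u) A = \<one>\<^bsub>pi1 X x\<^esub>))"


section \<open>Categories of spaces over a fixed space\<close>

record ('o, 'm) cat =
  Obj :: "'o set"
  Hom :: "'o \<Rightarrow> 'o \<Rightarrow> 'm set"
  Idt :: "'o \<Rightarrow> 'm"
  Comp :: "'o \<Rightarrow> 'o \<Rightarrow> 'o \<Rightarrow> 'm \<Rightarrow> 'm \<Rightarrow> 'm"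

definition is_category :: "('o, 'm) cat \<Rightarrow> bool" where
  "is_category C \<longleftrightarrow>
     (\<forall>a b. Hom C a b \<noteq> {} \<longrightarrow> a \<in> Obj C \<and> b \<in> Obj C) \<and>
     (\<forall>a \<in> Obj C. Idt C a \<in> Hom C a a) \<and>
     (\<forall>a b c. \<forall>f \<in> Hom C a b. \<forall>g \<in> Hom C b c. Comp C a b c g f \<in> Hom C a c) \<and>
     (\<forall>a b. \<forall>f \<in> Hom C a b.
        Comp C a a b f (Idt C a) = f \<and> Comp C a b b (Idt C b) f = f) \<and>
     (\<forall>a b c d. \<forall>f \<in> Hom C a b. \<forall>g \<in> Hom C b c. \<forall>h \<in> Hom C c d.
        Comp C a c d h (Comp C a b c g f) = Comp C a b d (Comp C b c d h g) f)"

text \<open>The full subcategory on the objects satisfying \<open>P\<close>; it shares identities and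
  composition with the ambient category.\<close>

definition full_subcat :: "('o, 'm) cat \<Rightarrow> ('o \<Rightarrow> bool) \<Rightarrow> ('o, 'm) cat" where
  "full_subcat C P = C\<lparr>
     Obj := {a \<in> Obj C. P a},
     Hom := (\<lambda>a b. if P a \<and> P b then Hom C a b else {})\<rparr>"

text \<open>Objects are pairs \<open>(Y, p)\<close> of a space \<open>Y\<close> and a map \<open>p\<close> from \<open>Y\<close> to \<open>X\<close>.
  The points of \<open>Y\<close> are taken from an arbitrary type \<open>'b\<close>, which plays the role
  of the universe.\<close>

definition Over :: "'a topology \<Rightarrow> ('b topology \<times> ('b \<Rightarrow> 'a), 'b \<Rightarrow> 'b) cat" where
  "Over X =
     \<lparr>Obj = {(Y, p). p \<in> maps Y X},
      Hom = (\<lambda>(Y, p) (Y', p').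
        {f \<in> maps Y Y'. p \<in> maps Y X \<and> p' \<in> maps Y' X \<and> compose (topspace Y) p' f = p}),
      Idt = (\<lambda>(Y, p). \<lambda>y \<in> topspace Y. y),
      Comp = (\<lambda>(Y, p) (Y', p') (Y'', p'') g f. compose (topspace Y) g f)\<rparr>"

lemma is_category_full_subcat: "is_category C \<Longrightarrow> is_category (full_subcat C P)"
  unfolding is_category_def full_subcat_def by (auto split: if_splits)

lemma is_category_Over: "is_category (Over X)"
  unfolding is_category_def
proof (intro conjI)
  note maps_simps = maps_def compose_def extensional_def restrict_def
    continuous_map_def Pi_iff fun_eq_iff
  have comp: "compose (topspace A) g f \<in> maps A C"
    if "f \<in> maps A B" "g \<in> maps B C" for A :: "'x topology" and B :: "'y topology"
      and C :: "'z topology" and f g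
    using that continuous_map_compose [of A B f C g]
    by (auto simp: maps_def compose_def o_def intro: continuous_map_eq)
  show "\<forall>a b. Hom (Over X) a b \<noteq> {} \<longrightarrow> a \<in> Obj (Over X) \<and> b \<in> Obj (Over X)"
    by (auto simp: Over_def)
  show "\<forall>a \<in> Obj (Over X). Idt (Over X) a \<in> Hom (Over X) a a"
    by (auto simp: Over_def maps_def compose_def extensional_def restrict_def fun_eq_iff
        intro: continuous_map_eq [OF continuous_map_id])
  show "\<forall>a b c. \<forall>f \<in> Hom (Over X) a b. \<forall>g \<in> Hom (Over X) b c.
      Comp (Over X) a b c g f \<in> Hom (Over X) a c"
    by (auto simp: Over_def comp) (auto simp: maps_simps)
  show "\<forall>a b. \<forall>f \<in> Hom (Over X) a b. Comp (Over X) a a b f (Idt (Over X) a) = f \<and>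
      Comp (Over X) a b b (Idt (Over X) b) f = f"
    by (auto simp: Over_def maps_simps)
  show "\<forall>a b c d. \<forall>f \<in> Hom (Over X) a b. \<forall>g \<in> Hom (Over X) b c. \<forall>h \<in> Hom (Over X) c d.
      Comp (Over X) a c d h (Comp (Over X) a b c g f)
        = Comp (Over X) a b d (Comp (Over X) b c d h g) f"
    by (auto simp: Over_def maps_simps)
qed

definition SCov :: "'a topology \<Rightarrow> ('b topology \<times> ('b \<Rightarrow> 'a), 'b \<Rightarrow> 'b) cat" where
  "SCov X = full_subcat (Over X) (\<lambda>(Y, p). semicovering_map Y X p)"

definition Cov :: "'a topology \<Rightarrow> ('b topology \<times> ('b \<Rightarrow> 'a), 'b \<Rightarrow> 'b) cat" where
  "Cov X = full_subcat (Over X) (\<lambda>(Y, p). covering_map Y X p)"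

definition SCov0 :: "'a topology \<Rightarrow> ('b topology \<times> ('b \<Rightarrow> 'a), 'b \<Rightarrow> 'b) cat" where
  "SCov0 X = full_subcat (SCov X) (\<lambda>(Y, p). topspace Y \<noteq> {} \<and> path_connected_space Y)"

definition Cov0 :: "'a topology \<Rightarrow> ('b topology \<times> ('b \<Rightarrow> 'a), 'b \<Rightarrow> 'b) cat" where
  "Cov0 X = full_subcat (Cov X) (\<lambda>(Y, p). topspace Y \<noteq> {} \<and> path_connected_space Y)"

end

theory Submission
  imports Defs
begin

text \<open>The categories in question are full subcategories of the same category of spaces over \<open>X\<close>, so
  the claim is that a map \<open>p\<close> from \<open>Y\<close> to \<open>X\<close> is a covering map if and only if it is a semicovering
  map.

  A covering map is a local homeomorphism and has unique lifts of paths. What remains is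
  topological: that lifting is continuous in the compact-open topology, and that homotopies lift.
  For continuity, \<open>lift_of_nearby_map\<close> shows that along a local homeomorphism every map close to
  \<open>p \<circ> f\<close> has a lift close to \<open>f\<close>, provided that the domain is compact Hausdorff; where lifts exist
  and are unique, lifting is therefore continuous (\<open>homeomorphic_map_based_maps\<close>). Homotopies
  then need no separate treatment: the triangle is a union of segments starting at its collapsed
  edge, and the endpoints of the lifts of these segments depend continuously on the point by
  \<open>lifted_endpoint_continuous\<close>. Hence continuous lifting of paths implies continuous lifting of
  homotopies.

  Conversely, for a semicovering the same continuity of lifted endpoints shows that a null homotopic
  loop lifts only to loops (\<open>lift_of_null_homotopic_loop_is_closed\<close>). If \<open>U\<close> is open, path
  connected, and so small that its loops at a point \<open>x\<close> of \<open>U\<close> are null homotopic in \<open>X\<close>, then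
  each path component of \<open>p\<inverse>(U)\<close> is mapped bijectively to \<open>U\<close>, so these components are the
  sheets of a covering.\<close>

section \<open>The compact-open topology\<close>

lemma openin_compact_open:
  assumes "compactin K C" "openin X U"
  shows "openin (compact_open K X) {f \<in> maps K X. f ` C \<subseteq> U}"
  unfolding compact_open_def by (rule topology_generated_by_Basis) (use assms in blast)

lemma continuous_map_into_compact_open:
  assumes "\<And>z. z \<in> topspace Z \<Longrightarrow> f z \<in> maps K X"
    and "\<And>C U. \<lbrakk>compactin K C; openin X U\<rbrakk> \<Longrightarrow> openin Z {z \<in> topspace Z. f z ` C \<subseteq> U}"
  shows "continuous_map Z (compact_open K X) f"
  unfolding compact_open_def
proof (rule continuous_on_generated_topo)
  fix S assume "S \<in> {{f \<in> maps K X. f ` C \<subseteq> U} |C U. compactin K C \<and> openin X U}"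
  then obtain C U where S: "S = {f \<in> maps K X. f ` C \<subseteq> U}" "compactin K C" "openin X U"
    by blast
  have "f -` S \<inter> topspace Z = {z \<in> topspace Z. f z ` C \<subseteq> U}"
    using assms(1) S by auto
  then show "openin Z (f -` S \<inter> topspace Z)"
    using assms(2) S by simp
next
  have "f ` topspace Z \<subseteq> maps K X" using assms(1) by blast
  also have "maps K X = {f \<in> maps K X. f ` {} \<subseteq> {}}" by simp
  finally show "f ` topspace Z \<subseteq> \<Union> {{f \<in> maps K X. f ` C \<subseteq> U} |C U. compactin K C \<and> openin X U}"
    using compactin_empty openin_empty by blast
qed

lemma restrict_in_maps:
  assumes "continuous_map K X f"
  shows "restrict f (topspace K) \<in> maps K X"
  using continuous_map_eq [OF assms, of "restrict f (topspace K)"] by (simp add: maps_def)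

lemma compose_in_maps:
  assumes "continuous_map K Y f" "continuous_map Y X p"
  shows "compose (topspace K) p f \<in> maps K X"
  using restrict_in_maps [OF continuous_map_compose [OF assms]]
  by (simp add: compose_def o_def)

lemma continuous_map_compact_open_compose:
  assumes p: "continuous_map Y X p"
  shows "continuous_map (compact_open K Y) (compact_open K X) (compose (topspace K) p)"
proof (rule continuous_map_into_compact_open)
  fix f assume "f \<in> topspace (compact_open K Y)"
  then show "compose (topspace K) p f \<in> maps K X"
    using compose_in_maps p by (auto simp: maps_def)
next
  fix C U assume C: "compactin K C" and U: "openin X U"
  let ?V = "{y \<in> topspace Y. p y \<in> U}"
  have "C \<subseteq> topspace K"
    using C compactin_subset_topspace by blast
  then have "{f \<in> topspace (compact_open K Y). compose (topspace K) p f ` C \<subseteq> U}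
      = {f \<in> maps K Y. f ` C \<subseteq> ?V}"
    by (fastforce simp: maps_def compose_def dest: continuous_map_funspace)
  then show "openin (compact_open K Y)
      {f \<in> topspace (compact_open K Y). compose (topspace K) p f ` C \<subseteq> U}"
    using openin_compact_open [OF C openin_continuous_map_preimage [OF p U]] by simp
qed

lemma continuous_map_compact_open_eval:
  assumes "k \<in> topspace K"
  shows "continuous_map (compact_open K X) X (\<lambda>f. f k)"
  unfolding continuous_map_def
proof (intro conjI allI impI)
  show "(\<lambda>f. f k) \<in> topspace (compact_open K X) \<rightarrow> topspace X"
    using assms by (auto simp: maps_def dest: continuous_map_funspace)
  fix U assume "openin X U"
  then show "openin (compact_open K X) {f \<in> topspace (compact_open K X). f k \<in> U}"
    using openin_compact_open [of K "{k}" X U] assms by simp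
qed

text \<open>By the tube lemma, an open set that contains \<open>{z} \<times> C\<close> with \<open>C\<close> compact contains
  \<open>V \<times> C\<close> for some neighborhood \<open>V\<close> of \<open>z\<close>. This is the half of the exponential law that
  holds for every space \<open>K\<close>.\<close>

lemma continuous_map_curry_compact_open:
  assumes F: "continuous_map (prod_topology Z K) X F"
  shows "continuous_map Z (compact_open K X) (\<lambda>z. \<lambda>k\<in>topspace K. F (z, k))"
proof (rule continuous_map_into_compact_open)
  fix z assume "z \<in> topspace Z"
  then have "continuous_map K X (F \<circ> (\<lambda>k. (z, k)))"
    by (intro continuous_map_compose [OF _ F] continuous_map_pairedI) auto
  then show "(\<lambda>k\<in>topspace K. F (z, k)) \<in> maps K X"
    using restrict_in_maps by (fastforce simp: o_def)
next
  fix C U assume C: "compactin K C" and U: "openin X U"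
  let ?W = "{w \<in> topspace (prod_topology Z K). F w \<in> U}"
  have W: "openin (prod_topology Z K) ?W"
    using openin_continuous_map_preimage [OF F U] .
  have CK: "C \<subseteq> topspace K"
    using C compactin_subset_topspace by blast
  show "openin Z {z \<in> topspace Z. (\<lambda>k\<in>topspace K. F (z, k)) ` C \<subseteq> U}"
  proof (subst openin_subopen, safe)
    fix z assume z: "z \<in> topspace Z" and "(\<lambda>k\<in>topspace K. F (z, k)) ` C \<subseteq> U"
    then have zC: "{z} \<times> C \<subseteq> ?W"
      using CK by force
    have "compactin Z {z}"
      using z by simp
    then obtain V C' where V: "openin Z V" "openin K C'" "{z} \<subseteq> V" "C \<subseteq> C'" "V \<times> C' \<subseteq> ?W"
      by (rule Wallace_theorem_prod_topology [OF _ C W zC])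
    then have "V \<subseteq> {z \<in> topspace Z. (\<lambda>k\<in>topspace K. F (z, k)) ` C \<subseteq> U}"
      using CK openin_subset [OF V(1)] by force
    then show "\<exists>T. openin Z T \<and> z \<in> T \<and>
        T \<subseteq> {z \<in> topspace Z. (\<lambda>k\<in>topspace K. F (z, k)) ` C \<subseteq> U}"
      using V by blast
  qed
qed

section \<open>Lifting maps along a local homeomorphism\<close>

lemma local_homeomorphism_imp_open_map:
  assumes p: "local_homeomorphism Y X p"
  shows "open_map Y X p"
  unfolding open_map_def
proof (intro allI impI)
  fix U assume U: "openin Y U"
  show "openin X (p ` U)"
  proof (subst openin_subopen, safe)
    fix y assume y: "y \<in> U"
    then obtain V where V: "openin Y V" "y \<in> V" "openin X (p ` V)"
      and h: "homeomorphic_map (subtopology Y V) (subtopology X (p ` V)) p"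
      using p openin_subset [OF U] unfolding local_homeomorphism_def by blast
    have "openin (subtopology Y V) (U \<inter> V)"
      using U V by (simp add: openin_subtopology_Int)
    then have "openin (subtopology X (p ` V)) (p ` (U \<inter> V))"
      using homeomorphic_imp_open_map [OF h] by (simp add: open_map_def)
    then have "openin X (p ` (U \<inter> V))"
      using V openin_trans_full by blast
    then show "\<exists>T. openin X T \<and> p y \<in> T \<and> T \<subseteq> p ` U"
      using y V by blast
  qed
qed

text \<open>Cover \<open>K\<close> by finitely many closed sets \<open>T\<^sub>i\<close> that \<open>f\<close> maps into open sets \<open>W\<^sub>i\<close> on which \<open>p\<close>
  is a homeomorphism onto an open set. A map \<open>\<psi>\<close> close to \<open>p \<circ> f\<close> is lifted on \<open>T\<^sub>i\<close> by the
  inverse of \<open>p\<close> on \<open>W\<^sub>i\<close>. The pieces fit together because closeness to \<open>p \<circ> f\<close> is taken to include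
  the open condition \<open>\<psi>(T\<^sub>i \<inter> T\<^sub>j) \<subseteq> p(W\<^sub>i \<inter> W\<^sub>j)\<close>.
  The last clause of the conclusion is what preserves base points.\<close>

lemma lift_of_nearby_map:
  assumes p: "local_homeomorphism Y X p"
    and K: "compact_space K" "Hausdorff_space K"
    and f: "continuous_map K Y f"
    and C: "compactin K C" and V: "openin Y V" and fC: "f ` C \<subseteq> V"
  obtains N where "openin (compact_open K X) N" "compose (topspace K) p f \<in> N"
    "\<forall>\<psi> \<in> N. \<exists>g. continuous_map K Y g \<and> (\<forall>k \<in> topspace K. p (g k) = \<psi> k) \<and> g ` C \<subseteq> V
        \<and> (\<forall>k \<in> topspace K. \<psi> k = p (f k) \<longrightarrow> g k = f k)"
proof -
  have "\<forall>k \<in> topspace K. \<exists>W h Q T. openin Y W \<and>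
      homeomorphic_maps (subtopology Y W) (subtopology X (p ` W)) p h \<and>
      openin K Q \<and> closedin K T \<and> k \<in> Q \<and> Q \<subseteq> T \<and> f ` T \<subseteq> W"
  proof
    fix k assume k: "k \<in> topspace K"
    then have "f k \<in> topspace Y"
      using continuous_map_funspace [OF f] by auto
    then obtain W where W: "openin Y W" "f k \<in> W"
      and "homeomorphic_map (subtopology Y W) (subtopology X (p ` W)) p"
      using p unfolding local_homeomorphism_def by blast
    then obtain h where h: "homeomorphic_maps (subtopology Y W) (subtopology X (p ` W)) p h"
      using homeomorphic_map_maps by blast
    have "neighbourhood_base_of (closedin K) K"
      using compact_Hausdorff_imp_regular_space K neighbourhood_base_of_closedin by blast
    then obtain Q T where "openin K Q" "closedin K T" "k \<in> Q" "Q \<subseteq> T"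
      "T \<subseteq> {k \<in> topspace K. f k \<in> W}"
      using openin_continuous_map_preimage [OF f W(1)] k W(2)
      unfolding neighbourhood_base_of by (metis (mono_tags, lifting) mem_Collect_eq)
    then show "\<exists>W h Q T. openin Y W \<and>
      homeomorphic_maps (subtopology Y W) (subtopology X (p ` W)) p h \<and>
      openin K Q \<and> closedin K T \<and> k \<in> Q \<and> Q \<subseteq> T \<and> f ` T \<subseteq> W"
      using W h by blast
  qed
  then obtain W h Q T where sheets: "\<forall>k \<in> topspace K. openin Y (W k) \<and>
      homeomorphic_maps (subtopology Y (W k)) (subtopology X (p ` W k)) p (h k) \<and>
      openin K (Q k) \<and> closedin K (T k) \<and> k \<in> Q k \<and> Q k \<subseteq> T k \<and> f ` T k \<subseteq> W k"
    unfolding bchoice_iff by (elim exE) (rule that, assumption)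
  have W: "openin Y (W k)"
    and h: "homeomorphic_maps (subtopology Y (W k)) (subtopology X (p ` W k)) p (h k)"
    and Q: "openin K (Q k) \<and> k \<in> Q k \<and> Q k \<subseteq> T k"
    and T: "closedin K (T k)"
    and fT: "f ` T k \<subseteq> W k" if "k \<in> topspace K" for k
    using bspec [OF sheets that] by simp_all
  have hp: "h i (p w) = w" if "i \<in> topspace K" "w \<in> W i" for i w
    using h [OF that(1)] openin_subset [OF W [OF that(1)]] that(2)
    by (auto simp: homeomorphic_maps_def)
  have ph: "p (h i x) = x" if "i \<in> topspace K" "x \<in> p ` W i" for i x
    using hp that by auto
  have op: "openin X (p ` S)" if "openin Y S" for S
    using local_homeomorphism_imp_open_map [OF p] that by (simp add: open_map_def)
  obtain F where F: "finite F" "F \<subseteq> topspace K" and "topspace K \<subseteq> \<Union> (Q ` F)"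
  proof -
    have "\<exists>\<F>. finite \<F> \<and> \<F> \<subseteq> Q ` topspace K \<and> topspace K \<subseteq> \<Union>\<F>"
      by (rule compactinD) (use K Q in \<open>auto simp: compact_space_def\<close>)
    then show ?thesis
      using that by (metis finite_subset_image)
  qed
  then have cover: "\<exists>i\<in>F. k \<in> T i" if "k \<in> topspace K" for k
    using that Q F by blast
  have FK: "i \<in> topspace K" if "i \<in> F" for i
    using F(2) that by blast
  have T_subset: "T i \<subseteq> topspace K" if "i \<in> F" for i
    using closedin_subset [OF T [OF FK [OF that]]] .
  have T_compact: "compactin K (T i)" if "i \<in> F" for i
    using closedin_compact_space [OF K(1) T [OF FK [OF that]]] .
  \<comment> \<open>On \<open>T i\<close> the lift will be \<open>h i \<circ> \<psi>\<close>. The condition on \<open>T i \<inter> T j\<close> makes the pieces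
    agree: their common value is the point of \<open>W i \<inter> W j\<close> over \<open>\<psi> k\<close>.\<close>
  define N where "N =
    ((\<Inter>ij\<in>F \<times> F. {\<psi> \<in> maps K X. \<psi> ` (T (fst ij) \<inter> T (snd ij)) \<subseteq> p ` (W (fst ij) \<inter> W (snd ij))})
      \<inter> topspace (compact_open K X))
    \<inter> ((\<Inter>i\<in>F. {\<psi> \<in> maps K X. \<psi> ` (T i \<inter> C) \<subseteq> p ` (W i \<inter> V)}) \<inter> topspace (compact_open K X))"
  show ?thesis
  proof
    have TT: "compactin K (T i \<inter> T j)" if "i \<in> F" "j \<in> F" for i j
      using closed_Int_compactin [OF T [OF FK [OF that(1)]] T_compact [OF that(2)]] .
    have TC: "compactin K (T i \<inter> C)" if "i \<in> F" for i
      using closed_Int_compactin [OF T [OF FK [OF that]] C] .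
    have WW: "openin X (p ` (W i \<inter> W j))" if "i \<in> F" "j \<in> F" for i j
      using W [OF FK [OF that(1)]] W [OF FK [OF that(2)]] by (intro op openin_Int)
    have WV: "openin X (p ` (W i \<inter> V))" if "i \<in> F" for i
      using W [OF FK [OF that]] V by (intro op openin_Int)
    show "openin (compact_open K X) N"
      unfolding N_def
    proof (intro openin_Int [OF openin_INT openin_INT] openin_compact_open)
      show "finite (F \<times> F)" "finite F"
        using F(1) by simp_all
    qed (use TT TC WW WV in \<open>simp_all add: mem_Times_iff\<close>)
    have fW: "f k \<in> W i" if "i \<in> F" "k \<in> T i" for i k
      using fT [OF FK [OF that(1)]] that(2) by blast
    have "(compose (topspace K) p f) ` (T i \<inter> T j) \<subseteq> p ` (W i \<inter> W j)" if "i \<in> F" "j \<in> F" for i j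
      using fW that T_subset [OF that(1)] by (fastforce simp: compose_def)
    moreover have "(compose (topspace K) p f) ` (T i \<inter> C) \<subseteq> p ` (W i \<inter> V)" if "i \<in> F" for i
      using fW that fC T_subset [OF that] by (fastforce simp: compose_def)
    moreover have "compose (topspace K) p f \<in> maps K X"
      using p compose_in_maps [OF f, of X p] unfolding local_homeomorphism_def by blast
    ultimately show "compose (topspace K) p f \<in> N"
      by (simp add: N_def)
  next
    show "\<forall>\<psi> \<in> N. \<exists>g. continuous_map K Y g \<and> (\<forall>k \<in> topspace K. p (g k) = \<psi> k) \<and> g ` C \<subseteq> V
        \<and> (\<forall>k \<in> topspace K. \<psi> k = p (f k) \<longrightarrow> g k = f k)"
    proof
      fix \<psi> assume \<psi>: "\<psi> \<in> N"
      have \<psi>c: "continuous_map K X \<psi>"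
        using \<psi> by (simp add: N_def maps_def)
      have \<psi>_overlap: "\<forall>i\<in>F. \<forall>j\<in>F. \<psi> ` (T i \<inter> T j) \<subseteq> p ` (W i \<inter> W j)"
        and \<psi>_C: "\<forall>i\<in>F. \<psi> ` (T i \<inter> C) \<subseteq> p ` (W i \<inter> V)"
        using \<psi> by (simp_all add: N_def)
      have \<psi>1: "\<psi> k \<in> p ` (W i \<inter> W j)" if "i \<in> F" "j \<in> F" "k \<in> T i" "k \<in> T j" for i j k
        using \<psi>_overlap that by (meson IntI image_subset_iff)
      have \<psi>2: "\<psi> k \<in> p ` (W i \<inter> V)" if "i \<in> F" "k \<in> T i" "k \<in> C" for i k
        using \<psi>_C that by (meson IntI image_subset_iff)
      define g where "g = (\<lambda>k. h (SOME i. i \<in> F \<and> k \<in> T i) (\<psi> k))"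
      have agree: "h i (\<psi> k) = h j (\<psi> k)" if ij: "i \<in> F" "j \<in> F" "k \<in> T i" "k \<in> T j" for i j k
      proof -
        obtain w where w: "w \<in> W i" "w \<in> W j" "\<psi> k = p w"
          using \<psi>1 [OF ij] by blast
        then show ?thesis
          using hp [OF FK [OF ij(1)] w(1)] hp [OF FK [OF ij(2)] w(2)] by simp
      qed
      have g: "g k = h i (\<psi> k)" if "i \<in> F" "k \<in> T i" for i k
      proof -
        have "(SOME i. i \<in> F \<and> k \<in> T i) \<in> F \<and> k \<in> T (SOME i. i \<in> F \<and> k \<in> T i)"
          by (rule someI [of _ i]) (use that in simp)
        then show ?thesis
          unfolding g_def using agree that by blast
      qed
      have "continuous_map K Y g"
      proof (rule pasting_lemma_closed [where I = F and T = T and f = "\<lambda>i. h i \<circ> \<psi>"])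
        show "finite F" by fact
        show "closedin K (T i)" if "i \<in> F" for i
          using T [OF FK [OF that]] .
        show "continuous_map (subtopology K (T i)) Y (h i \<circ> \<psi>)" if "i \<in> F" for i
        proof (rule continuous_map_compose)
          show "continuous_map (subtopology K (T i)) (subtopology X (p ` W i)) \<psi>"
            using continuous_map_from_subtopology [OF \<psi>c] \<psi>1 [OF that that]
            unfolding continuous_map_in_subtopology by auto
          show "continuous_map (subtopology X (p ` W i)) Y (h i)"
            using h [OF FK [OF that]] by (simp add: homeomorphic_maps_def continuous_map_in_subtopology)
        qed
        show "(h i \<circ> \<psi>) k = (h j \<circ> \<psi>) k" if "i \<in> F" "j \<in> F" "k \<in> topspace K \<inter> T i \<inter> T j" for i j k
          using agree [of i j k] that by simp
        show "\<exists>j. j \<in> F \<and> k \<in> T j \<and> g k = (h j \<circ> \<psi>) k" if "k \<in> topspace K" for k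
        proof -
          obtain i where i: "i \<in> F" "k \<in> T i"
            using cover \<open>k \<in> topspace K\<close> by blast
          then show ?thesis
            using g [OF i] by (intro exI [of _ i]) simp
        qed
      qed
      moreover have "p (g k) = \<psi> k" if "k \<in> topspace K" for k
      proof -
        obtain i where i: "i \<in> F" "k \<in> T i"
          using cover \<open>k \<in> topspace K\<close> by blast
        then have "\<psi> k \<in> p ` W i"
          using \<psi>1 [of i i k] by simp
        then show ?thesis
          using g [OF i] ph [OF FK [OF i(1)]] by simp
      qed
      moreover have "g ` C \<subseteq> V"
      proof
        fix y assume "y \<in> g ` C"
        then obtain k where k: "k \<in> C" "y = g k" by blast
        then obtain i where i: "i \<in> F" "k \<in> T i"
          using cover compactin_subset_topspace [OF C] by blast
        then obtain w where "w \<in> W i" "w \<in> V" "\<psi> k = p w"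
          using \<psi>2 [OF i k(1)] by blast
        then show "y \<in> V"
          using k(2) g [OF i] hp [OF FK [OF i(1)]] by simp
      qed
      moreover have "g k = f k" if "k \<in> topspace K" "\<psi> k = p (f k)" for k
      proof -
        obtain i where i: "i \<in> F" "k \<in> T i"
          using cover \<open>k \<in> topspace K\<close> by blast
        then have "f k \<in> W i"
          using fT [OF FK] by blast
        then show ?thesis
          using g [OF i] hp [OF FK [OF i(1)]] that(2) by simp
      qed
      ultimately show "\<exists>g. continuous_map K Y g \<and> (\<forall>k \<in> topspace K. p (g k) = \<psi> k) \<and> g ` C \<subseteq> V
          \<and> (\<forall>k \<in> topspace K. \<psi> k = p (f k) \<longrightarrow> g k = f k)"
        by blast
    qed
  qed
qed

text \<open>Paths from a point (\<open>K = [0,1]\<close>, \<open>B = {0}\<close>) and triangles with one collapsed edge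
  (\<open>K = Delta2\<close>, \<open>B = edge1\<close>) are instances of this space, so that the topology of both
  lifting maps can be treated at once.\<close>

definition based_maps :: "'k topology \<Rightarrow> 'k set \<Rightarrow> 'a topology \<Rightarrow> 'a \<Rightarrow> ('k \<Rightarrow> 'a) topology" where
  "based_maps K B X x = subtopology (compact_open K X) {f. \<forall>b \<in> B. f b = x}"

lemma topspace_based_maps [simp]:
  "topspace (based_maps K B X x) = {f \<in> maps K X. \<forall>b \<in> B. f b = x}"
  by (auto simp: based_maps_def)

text \<open>Composition with \<open>p\<close> is always continuous. If it is bijective, then the lift of \<open>\<psi>\<close> is the only
  lift, hence it is the one that \<open>lift_of_nearby_map\<close> provides, and this one stays in a
  prescribed subbasic open set when \<open>\<psi>\<close> varies slightly.\<close>

lemma homeomorphic_map_based_maps: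
  assumes p: "local_homeomorphism Y X p"
    and K: "compact_space K" "Hausdorff_space K" "B \<subseteq> topspace K"
    and bij: "bij_betw (compose (topspace K) p)
      (topspace (based_maps K B Y y)) (topspace (based_maps K B X (p y)))"
  shows "homeomorphic_map (based_maps K B Y y) (based_maps K B X (p y)) (compose (topspace K) p)"
proof -
  let ?P = "compose (topspace K) p"
  let ?Y = "based_maps K B Y y" and ?X = "based_maps K B X (p y)"
  let ?L = "inv_into (topspace ?Y) ?P"
  have pc: "continuous_map Y X p"
    using p by (simp add: local_homeomorphism_def)
  have L: "?L \<psi> \<in> topspace ?Y" "?P (?L \<psi>) = \<psi>" if "\<psi> \<in> topspace ?X" for \<psi>
    using bij that inv_into_into [of \<psi> ?P "topspace ?Y"] f_inv_into_f [of \<psi> ?P "topspace ?Y"]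
    unfolding bij_betw_def by auto
  have LP: "?L (?P f) = f" if "f \<in> topspace ?Y" for f
    using bij that inv_into_f_f unfolding bij_betw_def by metis
  have "continuous_map ?Y (compact_open K X) ?P"
    unfolding based_maps_def
    by (intro continuous_map_from_subtopology continuous_map_compact_open_compose pc)
  then have cont: "continuous_map ?Y ?X ?P"
    using bij unfolding bij_betw_def based_maps_def continuous_map_in_subtopology by auto
  have "continuous_map ?X (compact_open K Y) ?L"
  proof (rule continuous_map_into_compact_open)
    show "?L \<psi> \<in> maps K Y" if "\<psi> \<in> topspace ?X" for \<psi>
      using L(1) [OF that] by simp
  next
    fix C V assume C: "compactin K C" and V: "openin Y V"
    show "openin ?X {\<psi> \<in> topspace ?X. ?L \<psi> ` C \<subseteq> V}"
    proof (subst openin_subopen, rule ballI)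
      fix \<psi> assume "\<psi> \<in> {\<psi> \<in> topspace ?X. ?L \<psi> ` C \<subseteq> V}"
      then have \<psi>: "\<psi> \<in> topspace ?X" and LC: "?L \<psi> ` C \<subseteq> V"
        by auto
      have Lc: "continuous_map K Y (?L \<psi>)"
        using L(1) [OF \<psi>] by (simp add: maps_def)
      obtain N where N: "openin (compact_open K X) N" "?P (?L \<psi>) \<in> N"
        and lift: "\<forall>\<psi>' \<in> N. \<exists>g. continuous_map K Y g \<and> (\<forall>k \<in> topspace K. p (g k) = \<psi>' k)
            \<and> g ` C \<subseteq> V \<and> (\<forall>k \<in> topspace K. \<psi>' k = p (?L \<psi> k) \<longrightarrow> g k = ?L \<psi> k)"
        by (rule lift_of_nearby_map [OF p K(1,2) Lc C V LC])
      have "N \<inter> topspace ?X \<subseteq> {\<psi> \<in> topspace ?X. ?L \<psi> ` C \<subseteq> V}"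
      proof safe
        fix \<psi>' k assume \<psi>': "\<psi>' \<in> N" "\<psi>' \<in> topspace ?X" and k: "k \<in> C"
        obtain g where g: "continuous_map K Y g" "\<And>k. k \<in> topspace K \<Longrightarrow> p (g k) = \<psi>' k"
          "g ` C \<subseteq> V" "\<And>k. k \<in> topspace K \<Longrightarrow> \<psi>' k = p (?L \<psi> k) \<Longrightarrow> g k = ?L \<psi> k"
          using bspec [OF lift \<psi>'(1)] by blast
        have "g b = y" if "b \<in> B" for b
          using that g(4) [of b] K(3) L(1) [OF \<psi>] \<psi>'(2) by auto
        then have gY: "restrict g (topspace K) \<in> topspace ?Y"
          using restrict_in_maps [OF g(1)] K(3) by auto
        have "?P (restrict g (topspace K)) = \<psi>'"
          using \<psi>'(2) g(2) by (auto simp: compose_def maps_def extensional_def fun_eq_iff)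
        then have "?L \<psi>' = restrict g (topspace K)"
          using LP [OF gY] by simp
        then show "?L \<psi>' k \<in> V"
          using g(3) k compactin_subset_topspace [OF C] by auto
      qed
      moreover have "openin ?X (N \<inter> topspace ?X)"
        using N(1) by (auto simp: based_maps_def openin_subtopology)
      moreover have "\<psi> \<in> N \<inter> topspace ?X"
        using N(2) L(2) \<psi> by simp
      ultimately show "\<exists>T. openin ?X T \<and> \<psi> \<in> T \<and> T \<subseteq> {\<psi> \<in> topspace ?X. ?L \<psi> ` C \<subseteq> V}"
        by blast
    qed
  qed
  then have "continuous_map ?X ?Y ?L"
    using L(1) unfolding based_maps_def [of K B Y] continuous_map_in_subtopology by auto
  then have "homeomorphic_maps ?Y ?X ?P ?L"
    using cont L(2) LP unfolding homeomorphic_maps_def by blast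
  then show ?thesis
    using homeomorphic_map_maps by blast
qed

section \<open>Continuous lifting of paths and of homotopies\<close>

lemma paths_from_eq_based_maps:
  "paths_from X x = based_maps (top_of_set {0..1}) {0} X x"
  by (simp add: paths_from_def based_maps_def)

lemma triangles_from_eq_based_maps:
  "triangles_from X x = based_maps (top_of_set Delta2) edge1 X x"
proof -
  have "edge1 \<noteq> {}"
    by (auto simp: edge1_def)
  then have "{\<phi>. \<phi> ` edge1 = {x}} = {\<phi>. \<forall>b \<in> edge1. \<phi> b = x}"
    by auto
  then show ?thesis
    by (simp add: triangles_from_def based_maps_def)
qed

lemma compact_Delta2: "compact Delta2"
proof -
  have "Delta2 = ({0..1} \<times> {0..1}) \<inter> {z. fst z + snd z \<le> 1}"
    by (auto simp: Delta2_def)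
  moreover have "closed {z :: real \<times> real. fst z + snd z \<le> 1}"
    by (intro closed_Collect_le continuous_intros)
  ultimately show ?thesis
    by (metis compact_Icc compact_Int_closed compact_Times)
qed

lemma pathin_in_topspace:
  assumes "pathin X g" "t \<in> {0..1}"
  shows "g t \<in> topspace X"
  using assms continuous_map_funspace by (fastforce simp: pathin_def)

lemma edge1_subset_Delta2: "edge1 \<subseteq> Delta2"
  by (auto simp: edge1_def Delta2_def)

text \<open>Over a local homeomorphism the topological part of the lifting property is automatic; only
  existence and uniqueness of lifts are to be checked.\<close>

lemma continuous_lifting_of_pathsI:
  assumes p: "local_homeomorphism Y X p"
    and ex: "\<And>\<alpha> y. \<lbrakk>pathin X \<alpha>; y \<in> topspace Y; \<alpha> 0 = p y\<rbrakk> \<Longrightarrow>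
      \<exists>g. pathin Y g \<and> g 0 = y \<and> (\<forall>t \<in> {0..1}. p (g t) = \<alpha> t)"
    and uniq: "\<And>g h t. \<lbrakk>pathin Y g; pathin Y h; g 0 = h 0;
      \<forall>t \<in> {0..1}. p (g t) = p (h t); t \<in> {0..1}\<rbrakk> \<Longrightarrow> g t = h t"
  shows "continuous_lifting_of_paths Y X p"
  unfolding continuous_lifting_of_paths_def
proof
  fix y assume y: "y \<in> topspace Y"
  let ?I = "top_of_set {0..1::real}"
  have pc: "continuous_map Y X p"
    using p by (simp add: local_homeomorphism_def)
  have "bij_betw (compose (topspace ?I) p)
      (topspace (based_maps ?I {0} Y y)) (topspace (based_maps ?I {0} X (p y)))"
    unfolding bij_betw_def
  proof
    show "inj_on (compose (topspace ?I) p) (topspace (based_maps ?I {0} Y y))"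
    proof (rule inj_onI)
      fix g h assume g: "g \<in> topspace (based_maps ?I {0} Y y)"
        and h: "h \<in> topspace (based_maps ?I {0} Y y)"
        and "compose (topspace ?I) p g = compose (topspace ?I) p h"
      then have "\<forall>t \<in> {0..1}. p (g t) = p (h t)"
        by (metis compose_eq topspace_euclidean_subtopology)
      then show "g = h"
        using g h uniq [of g h] by (intro extensionalityI [of g "{0..1}" h]) (auto simp: maps_def pathin_def)
    qed
    show "compose (topspace ?I) p ` topspace (based_maps ?I {0} Y y)
        = topspace (based_maps ?I {0} X (p y))"
    proof (intro equalityI subsetI)
      fix \<alpha> assume "\<alpha> \<in> compose (topspace ?I) p ` topspace (based_maps ?I {0} Y y)"
      then show "\<alpha> \<in> topspace (based_maps ?I {0} X (p y))"
        using compose_in_maps [OF _ pc, of ?I] by (auto simp: maps_def compose_def)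
    next
      fix \<alpha> assume \<alpha>: "\<alpha> \<in> topspace (based_maps ?I {0} X (p y))"
      then obtain g where g: "pathin Y g" "g 0 = y" "\<forall>t \<in> {0..1}. p (g t) = \<alpha> t"
        using ex [of \<alpha> y] y by (auto simp: maps_def pathin_def)
      have "restrict g {0..1} \<in> topspace (based_maps ?I {0} Y y)"
        using restrict_in_maps [of ?I Y g] g by (simp add: pathin_def)
      moreover have "compose (topspace ?I) p (restrict g {0..1}) = \<alpha>"
        using g(3) \<alpha> by (auto simp: compose_def maps_def extensional_def fun_eq_iff)
      ultimately show "\<alpha> \<in> compose (topspace ?I) p ` topspace (based_maps ?I {0} Y y)"
        by blast
    qed
  qed
  then show "homeomorphic_map (paths_from Y y) (paths_from X (p y)) (compose {0..1} p)"
    using homeomorphic_map_based_maps [OF p, of ?I "{0}" y]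
    by (simp add: paths_from_eq_based_maps compact_space_subtopology Hausdorff_space_subtopology)
qed

lemma path_lift_exists:
  assumes lift: "continuous_lifting_of_paths Y X p"
    and "pathin X \<alpha>" "y \<in> topspace Y" "\<alpha> 0 = p y"
  shows "\<exists>g. pathin Y g \<and> g 0 = y \<and> (\<forall>t \<in> {0..1}. p (g t) = \<alpha> t)"
proof -
  have "compose {0..1} p ` topspace (paths_from Y y) = topspace (paths_from X (p y))"
    using lift assms(3) homeomorphic_imp_surjective_map
    by (fastforce simp: continuous_lifting_of_paths_def)
  moreover have "restrict \<alpha> {0..1} \<in> topspace (paths_from X (p y))"
    using restrict_in_maps [of "top_of_set {0..1}" X \<alpha>] assms
    by (simp add: paths_from_eq_based_maps pathin_def)
  ultimately obtain g where g: "g \<in> topspace (paths_from Y y)"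
    "compose {0..1} p g = restrict \<alpha> {0..1}"
    by (metis imageE)
  have "p (g t) = \<alpha> t" if "t \<in> {0..1}" for t
    using g(2) that by (metis compose_eq restrict_apply')
  then show ?thesis
    using g(1) by (intro exI [of _ g]) (auto simp: paths_from_eq_based_maps maps_def pathin_def)
qed

lemma path_lift_unique:
  assumes lift: "continuous_lifting_of_paths Y X p"
    and g: "pathin Y g" and h: "pathin Y h" and eq: "g 0 = h 0"
    and pgh: "\<And>t. t \<in> {0..1} \<Longrightarrow> p (g t) = p (h t)"
    and t: "t \<in> {0..1}"
  shows "g t = h t"
proof -
  have "g 0 \<in> topspace Y"
    using pathin_in_topspace [OF g] by simp
  then have "inj_on (compose {0..1} p) (topspace (paths_from Y (g 0)))"
    using lift homeomorphic_imp_injective_map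
    by (fastforce simp: continuous_lifting_of_paths_def)
  moreover have "restrict g {0..1} \<in> topspace (paths_from Y (g 0))"
    "restrict h {0..1} \<in> topspace (paths_from Y (g 0))"
    using restrict_in_maps [of "top_of_set {0..1}" Y g] restrict_in_maps [of "top_of_set {0..1}" Y h]
      g h eq by (simp_all add: paths_from_eq_based_maps pathin_def)
  moreover have "compose {0..1} p (restrict g {0..1}) = compose {0..1} p (restrict h {0..1})"
    using pgh by (auto simp: compose_def fun_eq_iff)
  ultimately have "restrict g {0..1} = restrict h {0..1}"
    by (meson inj_onD)
  then show ?thesis
    using t by (metis restrict_apply')
qed

text \<open>A family of paths \<open>F(z, -)\<close> with common starting point is a continuous map from \<open>Z\<close> to the space
  of paths. Lifting is continuous by hypothesis, and so is evaluation at \<open>1\<close>.\<close>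

lemma lifted_endpoint_continuous:
  assumes lift: "continuous_lifting_of_paths Y X p"
    and y: "y \<in> topspace Y"
    and F: "continuous_map (prod_topology Z (top_of_set {0..1})) X F"
    and F0: "\<And>z. z \<in> topspace Z \<Longrightarrow> F (z, 0) = p y"
  obtains e where "continuous_map Z Y e"
    "\<And>z. z \<in> topspace Z \<Longrightarrow>
      \<exists>g. pathin Y g \<and> g 0 = y \<and> (\<forall>t \<in> {0..1}. p (g t) = F (z, t)) \<and> g 1 = e z"
proof -
  let ?I = "top_of_set {0..1::real}"
  obtain L where L: "homeomorphic_maps (paths_from Y y) (paths_from X (p y)) (compose {0..1} p) L"
    using lift y homeomorphic_map_maps by (metis continuous_lifting_of_paths_def)
  define c where "c = (\<lambda>z. \<lambda>t\<in>{0..1}. F (z, t))"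
  have c: "continuous_map Z (paths_from X (p y)) c"
    unfolding paths_from_def continuous_map_in_subtopology
    using continuous_map_curry_compact_open [OF F] F0 by (auto simp: c_def)
  have Lc: "continuous_map Z (paths_from Y y) (L \<circ> c)"
    using L continuous_map_compose [OF c, of "paths_from Y y" L] by (simp add: homeomorphic_maps_def)
  show ?thesis
  proof
    have "continuous_map (paths_from Y y) Y (\<lambda>f. f 1)"
      unfolding paths_from_def
      by (intro continuous_map_from_subtopology continuous_map_compact_open_eval) simp
    from continuous_map_compose [OF Lc this]
    show "continuous_map Z Y (\<lambda>z. L (c z) 1)"
      by (simp add: o_def)
  next
    fix z assume z: "z \<in> topspace Z"
    have cz: "c z \<in> topspace (paths_from X (p y))" and "L (c z) \<in> topspace (paths_from Y y)"
      using z continuous_map_funspace [OF c] continuous_map_funspace [OF Lc] by auto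
    then have "pathin Y (L (c z))" "L (c z) 0 = y"
      by (auto simp: paths_from_eq_based_maps maps_def pathin_def)
    moreover have "compose {0..1} p (L (c z)) = c z"
      using L cz by (auto simp: homeomorphic_maps_def)
    then have "p (L (c z) t) = F (z, t)" if "t \<in> {0..1}" for t
      using that by (metis c_def compose_eq restrict_apply')
    ultimately show "\<exists>g. pathin Y g \<and> g 0 = y \<and> (\<forall>t \<in> {0..1}. p (g t) = F (z, t)) \<and> g 1 = L (c z) 1"
      by blast
  qed
qed

lemma path_over_constant:
  assumes lift: "continuous_lifting_of_paths Y X p"
    and g: "pathin Y g" and const: "\<And>t. t \<in> {0..1} \<Longrightarrow> p (g t) = p (g 0)"
    and t: "t \<in> {0..1}"
  shows "g t = g 0"
proof (rule path_lift_unique [OF lift g, where h = "\<lambda>_. g 0"])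
  have "g 0 \<in> topspace Y"
    using pathin_in_topspace [OF g] by simp
  then show "pathin Y (\<lambda>_. g 0)"
    by simp
qed (simp, fact const, fact t)

text \<open>Lift every stage of the null homotopy, starting at \<open>g 0\<close>. The endpoints of the lifts form a path
  over a single point of \<open>X\<close>, and such a path is constant because the constant path is a lift too.\<close>

lemma lift_of_null_homotopic_loop_is_closed:
  assumes lift: "continuous_lifting_of_paths Y X p"
    and g: "pathin Y g"
    and hom: "path_homotopic X (\<lambda>t. p (g 0)) (p \<circ> g)"
  shows "g 1 = g 0"
proof -
  let ?I = "top_of_set {0..1::real}"
  have y: "g 0 \<in> topspace Y"
    using pathin_in_topspace [OF g] by simp
  obtain h where h: "continuous_map (prod_topology ?I ?I) X h"
    and h0: "\<And>t. h (0, t) = p (g 0)" and h1: "\<And>t. h (1, t) = p (g t)"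
    and ends: "\<And>s. s \<in> {0..1} \<Longrightarrow> h (s, 0) = p (g 0) \<and> h (s, 1) = p (g 0)"
    using hom unfolding path_homotopic_def homotopic_with_def by auto
  obtain e where e: "continuous_map ?I Y e"
    "\<And>s. s \<in> {0..1} \<Longrightarrow>
      \<exists>k. pathin Y k \<and> k 0 = g 0 \<and> (\<forall>t \<in> {0..1}. p (k t) = h (s, t)) \<and> k 1 = e s"
    using lifted_endpoint_continuous [OF lift y h] ends
    by (metis topspace_euclidean_subtopology)
  obtain k0 where k0: "pathin Y k0" "k0 0 = g 0" "\<And>t. t \<in> {0..1} \<Longrightarrow> p (k0 t) = h (0, t)" "k0 1 = e 0"
    using e(2) [of 0] by auto
  have "e 0 = g 0"
    using path_over_constant [OF lift k0(1), of 1] k0 h0 by simp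
  moreover have "p (e s) = p (g 0)" if "s \<in> {0..1}" for s
    using e(2) [OF that] ends [OF that] by (metis atLeastAtMost_iff order_refl zero_le_one)
  ultimately have "e 1 = g 0"
    using path_over_constant [OF lift, of e 1] e(1) by (simp add: pathin_def)
  moreover obtain k1 where k1: "pathin Y k1" "k1 0 = g 0" "\<And>t. t \<in> {0..1} \<Longrightarrow> p (k1 t) = h (1, t)" "k1 1 = e 1"
    using e(2) [of 1] by auto
  have "k1 1 = g 1"
    by (rule path_lift_unique [OF lift k1(1) g]) (use k1 h1 in auto)
  ultimately show ?thesis
    using k1 by simp
qed

lemma pathin_radial_segment:
  assumes \<psi>: "continuous_map (top_of_set Delta2) Y \<psi>" and st: "(s, t) \<in> Delta2"
  shows "pathin Y (\<lambda>r. \<psi> (r * s, t))"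
proof -
  have "continuous_map (top_of_set {0..1}) (top_of_set Delta2) (\<lambda>r. (r * s, t))"
    unfolding continuous_map_subtopology_eu
  proof
    show "continuous_on {0..1} (\<lambda>r. (r * s, t))"
      by (intro continuous_intros)
    show "(\<lambda>r. (r * s, t)) \<in> {0..1} \<rightarrow> Delta2"
    proof
      fix r :: real assume "r \<in> {0..1}"
      moreover from this have "r * s \<le> s"
        using st by (intro mult_left_le_one_le) (auto simp: Delta2_def)
      ultimately show "(r * s, t) \<in> Delta2"
        using st by (auto simp: Delta2_def)
    qed
  qed
  from continuous_map_compose [OF this \<psi>] show ?thesis
    by (simp add: pathin_def o_def)
qed

text \<open>The collapsed edge of the triangle is \<open>s = 0\<close>, and every point \<open>(s, t)\<close> is joined to it by the
  segment \<open>r \<mapsto> (r s, t)\<close>. A triangle \<open>\<phi>\<close> with \<open>\<phi>(e\<^sub>1) = {x}\<close> is thus a continuous family of paths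
  from \<open>x\<close>, and the endpoints of their lifts form the unique lift of \<open>\<phi>\<close>.\<close>

lemma continuous_lifting_of_homotopies_if_paths:
  assumes p: "local_homeomorphism Y X p" and lift: "continuous_lifting_of_paths Y X p"
  shows "continuous_lifting_of_homotopies Y X p"
  unfolding continuous_lifting_of_homotopies_def
proof
  fix y assume y: "y \<in> topspace Y"
  let ?D = "top_of_set Delta2" and ?I = "top_of_set {0..1::real}"
  have pc: "continuous_map Y X p"
    using p by (simp add: local_homeomorphism_def)
  have edge: "(0, t) \<in> edge1" "(0, t) \<in> Delta2" if "(s, t) \<in> Delta2" for s t
    using that by (auto simp: edge1_def Delta2_def)
  have "bij_betw (compose (topspace ?D) p)
      (topspace (based_maps ?D edge1 Y y)) (topspace (based_maps ?D edge1 X (p y)))"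
    unfolding bij_betw_def
  proof
    show "inj_on (compose (topspace ?D) p) (topspace (based_maps ?D edge1 Y y))"
    proof (rule inj_onI)
      fix g h assume g: "g \<in> topspace (based_maps ?D edge1 Y y)"
        and h: "h \<in> topspace (based_maps ?D edge1 Y y)"
        and "compose (topspace ?D) p g = compose (topspace ?D) p h"
      then have pgh: "p (g z) = p (h z)" if "z \<in> Delta2" for z
        using that by (metis compose_eq topspace_euclidean_subtopology)
      have gc: "continuous_map ?D Y g" and hc: "continuous_map ?D Y h"
        using g h by (auto simp: maps_def)
      have "g (s, t) = h (s, t)" if st: "(s, t) \<in> Delta2" for s t
      proof -
        have "g (1 * s, t) = h (1 * s, t)"
        proof (rule path_lift_unique [OF lift pathin_radial_segment [OF gc st]
              pathin_radial_segment [OF hc st]])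
          show "g (0 * s, t) = h (0 * s, t)"
            using g h edge [OF st] by simp
          show "p (g (r * s, t)) = p (h (r * s, t))" if "r \<in> {0..1}" for r
          proof (rule pgh)
            have "r * s \<le> s"
              using st that by (intro mult_left_le_one_le) (auto simp: Delta2_def)
            then show "(r * s, t) \<in> Delta2"
              using st that by (auto simp: Delta2_def)
          qed
        qed simp
        then show ?thesis by simp
      qed
      then show "g = h"
        using g h by (intro extensionalityI [of g Delta2 h]) (auto simp: maps_def)
    qed
    show "compose (topspace ?D) p ` topspace (based_maps ?D edge1 Y y)
        = topspace (based_maps ?D edge1 X (p y))"
    proof (intro equalityI subsetI)
      fix \<phi> assume "\<phi> \<in> compose (topspace ?D) p ` topspace (based_maps ?D edge1 Y y)"
      then show "\<phi> \<in> topspace (based_maps ?D edge1 X (p y))"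
        using compose_in_maps [OF _ pc, of ?D] edge1_subset_Delta2
        by (auto simp: maps_def compose_def)
    next
      fix \<phi> assume \<phi>: "\<phi> \<in> topspace (based_maps ?D edge1 X (p y))"
      then have \<phi>c: "continuous_map ?D X \<phi>" and \<phi>0: "\<And>b. b \<in> edge1 \<Longrightarrow> \<phi> b = p y"
        by (auto simp: maps_def)
      define m :: "(real \<times> real) \<times> real \<Rightarrow> real \<times> real"
        where "m = (\<lambda>(z, r). (r * fst z, snd z))"
      have "continuous_map (prod_topology ?D ?I) ?D m"
        unfolding prod_topology_subtopology_eu continuous_map_subtopology_eu
      proof
        show "continuous_on (Delta2 \<times> {0..1}) m"
          unfolding m_def case_prod_unfold by (intro continuous_intros)
        show "m \<in> Delta2 \<times> {0..1} \<rightarrow> Delta2"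
        proof
          fix zr assume zr: "zr \<in> Delta2 \<times> {0..1 :: real}"
          then have "snd zr * fst (fst zr) \<le> fst (fst zr)"
            by (intro mult_left_le_one_le) (auto simp: Delta2_def)
          then show "m zr \<in> Delta2"
            using zr by (auto simp: Delta2_def m_def)
        qed
      qed
      then have F: "continuous_map (prod_topology ?D ?I) X (\<phi> \<circ> m)"
        by (rule continuous_map_compose [OF _ \<phi>c])
      have F0: "(\<phi> \<circ> m) (z, 0) = p y" if "z \<in> topspace ?D" for z
        using that edge [of "fst z" "snd z"] \<phi>0 by (simp add: m_def)
      obtain e where e: "continuous_map ?D Y e"
        "\<And>z. z \<in> Delta2 \<Longrightarrow>
          \<exists>g. pathin Y g \<and> g 0 = y \<and> (\<forall>r \<in> {0..1}. p (g r) = \<phi> (m (z, r))) \<and> g 1 = e z"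
        using lifted_endpoint_continuous [OF lift y F F0] by auto
      have pe: "p (e z) = \<phi> z" if z: "z \<in> Delta2" for z
      proof -
        obtain g where "\<forall>r \<in> {0..1}. p (g r) = \<phi> (m (z, r))" "g 1 = e z"
          using e(2) [OF z] by blast
        then have "p (e z) = \<phi> (m (z, 1))"
          by (metis atLeastAtMost_iff order_refl zero_le_one)
        then show ?thesis
          by (simp add: m_def)
      qed
      have e0: "e b = y" if b: "b \<in> edge1" for b
      proof -
        have bD: "b \<in> Delta2" and mb: "m (b, r) = b" for r
          using b edge1_subset_Delta2 by (auto simp: m_def edge1_def)
        obtain g where g: "pathin Y g" "g 0 = y" "\<forall>r \<in> {0..1}. p (g r) = \<phi> b" "g 1 = e b"
          using e(2) [OF bD] mb by auto
        then show ?thesis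
          using path_over_constant [OF lift g(1), of 1] \<phi>0 [OF b] by simp
      qed
      have "restrict e Delta2 \<in> topspace (based_maps ?D edge1 Y y)"
        using restrict_in_maps [OF e(1)] e0 edge1_subset_Delta2 by auto
      moreover have "compose (topspace ?D) p (restrict e Delta2) = \<phi>"
        using pe \<phi> by (auto simp: compose_def maps_def extensional_def fun_eq_iff)
      ultimately show "\<phi> \<in> compose (topspace ?D) p ` topspace (based_maps ?D edge1 Y y)"
        by blast
    qed
  qed
  then show "homeomorphic_map (triangles_from Y y) (triangles_from X (p y)) (compose Delta2 p)"
    using homeomorphic_map_based_maps [OF p, of ?D edge1 y] edge1_subset_Delta2
    by (simp add: triangles_from_eq_based_maps compact_space_subtopology compact_Delta2
        Hausdorff_space_subtopology)
qed

section \<open>Covering maps are semicoverings\<close>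

lemma covering_map_evenly_covered:
  assumes cov: "covering_map Y X p" and x: "x \<in> topspace X"
  obtains U \<V> where "openin X U" "x \<in> U" "\<Union>\<V> = {y \<in> topspace Y. p y \<in> U}"
    "\<forall>V \<in> \<V>. openin Y V" "pairwise disjnt \<V>"
    "\<forall>V \<in> \<V>. homeomorphic_map (subtopology Y V) (subtopology X U) p"
    "\<forall>V \<in> \<V>. p ` V = U" "\<forall>V \<in> \<V>. inj_on p V"
proof -
  obtain U \<V> where U: "openin X U" "x \<in> U" "\<Union>\<V> = {y \<in> topspace Y. p y \<in> U}"
    and V: "\<forall>V \<in> \<V>. openin Y V" "pairwise disjnt \<V>"
    and h: "\<forall>V \<in> \<V>. homeomorphic_map (subtopology Y V) (subtopology X U) p"
  proof -
    have "\<exists>U. openin X U \<and> x \<in> U \<and> (\<exists>\<V>. \<Union>\<V> = {y \<in> topspace Y. p y \<in> U} \<and>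
        (\<forall>V \<in> \<V>. openin Y V) \<and> pairwise disjnt \<V> \<and>
        (\<forall>V \<in> \<V>. homeomorphic_map (subtopology Y V) (subtopology X U) p))"
      using cov x by (simp add: covering_map_def)
    then show ?thesis
      by (elim exE conjE) (rule that)
  qed
  have "p ` V = U \<and> inj_on p V" if "V \<in> \<V>" for V
  proof -
    have hV: "homeomorphic_map (subtopology Y V) (subtopology X U) p"
      using h that by blast
    have "topspace (subtopology Y V) = V" "topspace (subtopology X U) = U"
      using openin_subset [OF bspec [OF V(1) that]] openin_subset [OF U(1)]
      by (auto simp: Int_absorb1)
    then show ?thesis
      using homeomorphic_imp_surjective_map [OF hV] homeomorphic_imp_injective_map [OF hV] by simp
  qed
  then show ?thesis
    using h V(1) by (intro that [OF U _ V(2)]) simp_all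
qed

lemma covering_map_imp_local_homeomorphism:
  assumes cov: "covering_map Y X p"
  shows "local_homeomorphism Y X p"
  unfolding local_homeomorphism_def
proof (intro conjI ballI)
  show pc: "continuous_map Y X p"
    using cov by (simp add: covering_map_def)
  fix y assume y: "y \<in> topspace Y"
  then have "p y \<in> topspace X"
    using continuous_map_funspace [OF pc] by blast
  from cov this obtain U \<V> where U: "openin X U" "p y \<in> U" "\<Union>\<V> = {y \<in> topspace Y. p y \<in> U}"
    "\<forall>V \<in> \<V>. openin Y V" "pairwise disjnt \<V>"
    "\<forall>V \<in> \<V>. homeomorphic_map (subtopology Y V) (subtopology X U) p"
    "\<forall>V \<in> \<V>. p ` V = U" "\<forall>V \<in> \<V>. inj_on p V"
    by (rule covering_map_evenly_covered)
  then obtain V where V: "V \<in> \<V>" "y \<in> V"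
    using y by blast
  have "openin X (p ` V)" "homeomorphic_map (subtopology Y V) (subtopology X (p ` V)) p"
    using U(1) bspec [OF U(6) V(1)] unfolding bspec [OF U(7) V(1)] .
  then show "\<exists>V. openin Y V \<and> y \<in> V \<and> openin X (p ` V) \<and>
      homeomorphic_map (subtopology Y V) (subtopology X (p ` V)) p"
    using U(4) V by blast
qed

lemma pathin_locally_in_open:
  assumes g: "pathin X g" and x: "x \<in> {0..1}" and U: "openin X U" "g x \<in> U"
  obtains d where "d > 0" "\<And>s. \<lbrakk>s \<in> {0..1}; \<bar>s - x\<bar> < d\<rbrakk> \<Longrightarrow> g s \<in> U"
proof -
  have "openin (top_of_set {0..1}) {s \<in> {0..1}. g s \<in> U}"
    using openin_continuous_map_preimage [of "top_of_set {0..1}" X g U] g U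
    by (simp add: pathin_def)
  then obtain d where "d > 0" "\<And>s. \<lbrakk>s \<in> {0..1}; dist s x < d\<rbrakk> \<Longrightarrow> s \<in> {s \<in> {0..1}. g s \<in> U}"
    using x U(2) unfolding openin_euclidean_subtopology_iff
    by (metis (mono_tags, lifting) mem_Collect_eq)
  then show ?thesis
    using that by (simp add: dist_real_def)
qed

text \<open>Bisection on the assertion that agreement at \<open>a\<close> implies agreement at \<open>b\<close>. Near \<open>x\<close> each of the
  two lifts stays in the sheet of its value at \<open>x\<close>; if they agree anywhere near \<open>x\<close>, then these
  sheets meet and hence coincide, and \<open>p\<close> is injective on a sheet.\<close>

lemma covering_map_path_lift_unique:
  assumes cov: "covering_map Y X p"
    and g: "pathin Y g" and h: "pathin Y h" and eq: "g 0 = h 0"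
    and pgh: "\<And>t. t \<in> {0..1} \<Longrightarrow> p (g t) = p (h t)"
    and t: "t \<in> {0..1}"
  shows "g t = h t"
proof -
  have pc: "continuous_map Y X p"
    using cov by (simp add: covering_map_def)
  \<comment> \<open>The guard is there because the short intervals of the bisection may leave \<open>[0, 1]\<close>.\<close>
  define P where "P a b \<longleftrightarrow> (0 \<le> a \<and> b \<le> 1 \<and> g a = h a \<longrightarrow> g b = h b)" for a b
  have "0 \<le> t"
    using t by simp
  then have "P 0 t"
  proof (induction rule: Bolzano)
    case (trans a b c)
    then show ?case by (auto simp: P_def)
  next
    case (local x)
    have x: "x \<in> {0..1}"
      using local t by simp
    have gx: "g x \<in> topspace Y" "h x \<in> topspace Y"
      using pathin_in_topspace g h x by metis+
    then have "p (g x) \<in> topspace X"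
      using continuous_map_funspace [OF pc] by blast
    from cov this obtain U \<V> where U: "openin X U" "p (g x) \<in> U" "\<Union>\<V> = {y \<in> topspace Y. p y \<in> U}"
    and \<V>: "\<forall>V \<in> \<V>. openin Y V" "pairwise disjnt \<V>"
    "\<forall>V \<in> \<V>. homeomorphic_map (subtopology Y V) (subtopology X U) p"
    "\<forall>V \<in> \<V>. p ` V = U" "\<forall>V \<in> \<V>. inj_on p V"
    by (rule covering_map_evenly_covered)
    have "p (h x) \<in> U"
      using U(2) pgh [OF x] by simp
    then have "g x \<in> \<Union>\<V>" "h x \<in> \<Union>\<V>"
      unfolding U(3) using U(2) gx by simp_all
    then obtain V W where V: "V \<in> \<V>" "g x \<in> V" and W: "W \<in> \<V>" "h x \<in> W"
      by (elim UnionE)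
    obtain d where d: "d > 0" "\<And>s. \<lbrakk>s \<in> {0..1}; \<bar>s - x\<bar> < d\<rbrakk> \<Longrightarrow> g s \<in> V"
      using pathin_locally_in_open [OF g x bspec [OF \<V>(1) V(1)] V(2)] by blast
    obtain e where e: "e > 0" "\<And>s. \<lbrakk>s \<in> {0..1}; \<bar>s - x\<bar> < e\<rbrakk> \<Longrightarrow> h s \<in> W"
      using pathin_locally_in_open [OF h x bspec [OF \<V>(1) W(1)] W(2)] by blast
    show ?case
      unfolding P_def
    proof (intro exI [of _ "min d e"] conjI allI impI)
      fix a b assume ab: "a \<le> x \<and> x \<le> b \<and> b - a < min d e" and *: "0 \<le> a \<and> b \<le> 1 \<and> g a = h a"
      then have a: "a \<in> {0..1}" "\<bar>a - x\<bar> < d" "\<bar>a - x\<bar> < e"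
        and b: "b \<in> {0..1}" "\<bar>b - x\<bar> < d" "\<bar>b - x\<bar> < e"
        using x by auto
      have "g a \<in> V \<inter> W"
        using * d(2) [OF a(1,2)] e(2) [OF a(1,3)] by simp
      then have "V = W"
        using pairwiseD [OF \<V>(2) V(1) W(1)] by (auto simp: disjnt_def)
      then have "g b \<in> V" "h b \<in> V"
        using d(2) [OF b(1,2)] e(2) [OF b(1,3)] by simp_all
      then show "g b = h b"
        using inj_onD [OF bspec [OF \<V>(5) V(1)] pgh [OF b(1)]] by blast
    qed (use d e in simp)
  qed
  then show ?thesis
    using t eq by (simp add: P_def)
qed

lemma continuous_map_join_intervals:
  fixes a b c :: real
  assumes f: "continuous_map (top_of_set {a..b}) Y f"
    and g: "continuous_map (top_of_set {b..c}) Y g" and fg: "f b = g b"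
    and "a \<le> b" "b \<le> c"
  shows "continuous_map (top_of_set {a..c}) Y (\<lambda>t. if t \<le> b then f t else g t)"
proof (rule continuous_map_cases_le)
  have "{a..c} \<inter> {t. t \<in> topspace (top_of_set {a..c}) \<and> t \<le> b} = {a..b}"
    "{a..c} \<inter> {t. t \<in> topspace (top_of_set {a..c}) \<and> b \<le> t} = {b..c}"
    using assms by auto
  then show "continuous_map (subtopology (top_of_set {a..c})
        {t. t \<in> topspace (top_of_set {a..c}) \<and> t \<le> b}) Y f"
    "continuous_map (subtopology (top_of_set {a..c})
        {t. t \<in> topspace (top_of_set {a..c}) \<and> b \<le> t}) Y g"
    unfolding subtopology_subtopology using f g by metis+
  show "continuous_map (top_of_set {a..c}) euclideanreal (\<lambda>t. t)"
    by (simp add: continuous_map_from_subtopology)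
qed (use fg in auto)

text \<open>Bisection on the assertion that lifts over \<open>[a, b]\<close> exist with arbitrary prescribed value at \<open>a\<close>;
  the freedom in this value is what allows adjacent intervals to be joined.\<close>

lemma covering_map_path_lift_exists:
  assumes cov: "covering_map Y X p"
    and \<alpha>: "pathin X \<alpha>" and y: "y \<in> topspace Y" and \<alpha>0: "\<alpha> 0 = p y"
  shows "\<exists>g. pathin Y g \<and> g 0 = y \<and> (\<forall>t \<in> {0..1}. p (g t) = \<alpha> t)"
proof -
  define P where "P a b \<longleftrightarrow> (0 \<le> a \<and> b \<le> 1 \<longrightarrow> (\<forall>y \<in> topspace Y. p y = \<alpha> a \<longrightarrow>
      (\<exists>g. continuous_map (top_of_set {a..b}) Y g \<and> g a = y \<and> (\<forall>t \<in> {a..b}. p (g t) = \<alpha> t))))"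
    for a b
  have "(0::real) \<le> 1"
    by simp
  then have "P 0 1"
  proof (induction rule: Bolzano)
    case (trans a b c)
    show ?case
      unfolding P_def
    proof (intro impI ballI)
      fix y assume ac: "0 \<le> a \<and> c \<le> 1" and y: "y \<in> topspace Y" "p y = \<alpha> a"
      obtain f where f: "continuous_map (top_of_set {a..b}) Y f" "f a = y"
        "\<And>t. t \<in> {a..b} \<Longrightarrow> p (f t) = \<alpha> t"
        using trans(1) ac y trans(3,4) unfolding P_def by fastforce
      have "f b \<in> topspace Y"
        using continuous_map_funspace [OF f(1)] trans(3) by auto
      moreover have "p (f b) = \<alpha> b"
        using f(3) trans(3) by simp
      ultimately obtain g where g: "continuous_map (top_of_set {b..c}) Y g" "g b = f b"
        "\<And>t. t \<in> {b..c} \<Longrightarrow> p (g t) = \<alpha> t"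
        using trans(2) ac trans(3,4) unfolding P_def by fastforce
      show "\<exists>g. continuous_map (top_of_set {a..c}) Y g \<and> g a = y \<and> (\<forall>t\<in>{a..c}. p (g t) = \<alpha> t)"
        using continuous_map_join_intervals [OF f(1) g(1)] f g trans(3,4)
        by (intro exI [of _ "\<lambda>t. if t \<le> b then f t else g t"]) auto
    qed
  next
    case (local x)
    then have x: "x \<in> {0..1}"
      by simp
    from cov pathin_in_topspace [OF \<alpha> x]
    obtain U \<V> where U: "openin X U" "\<alpha> x \<in> U" "\<Union>\<V> = {y \<in> topspace Y. p y \<in> U}"
    and \<V>: "\<forall>V \<in> \<V>. openin Y V" "pairwise disjnt \<V>"
    "\<forall>V \<in> \<V>. homeomorphic_map (subtopology Y V) (subtopology X U) p"
    "\<forall>V \<in> \<V>. p ` V = U" "\<forall>V \<in> \<V>. inj_on p V"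
    by (rule covering_map_evenly_covered)
    obtain d where d: "d > 0" "\<And>s. \<lbrakk>s \<in> {0..1}; \<bar>s - x\<bar> < d\<rbrakk> \<Longrightarrow> \<alpha> s \<in> U"
      using pathin_locally_in_open [OF \<alpha> x U(1,2)] by blast
    have "P a b" if ab: "a \<le> x" "x \<le> b" "b - a < d" for a b
      unfolding P_def
    proof (intro impI ballI)
      fix y assume ab01: "0 \<le> a \<and> b \<le> 1" and y: "y \<in> topspace Y" "p y = \<alpha> a"
      have \<alpha>U: "\<alpha> s \<in> U" if "s \<in> {a..b}" for s
        using that ab ab01 by (intro d(2)) auto
      have "\<alpha> a \<in> U"
        using \<alpha>U ab by simp
      then have "y \<in> \<Union>\<V>"
        unfolding U(3) using y by simp
      then obtain V where V: "V \<in> \<V>" "y \<in> V"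
        by (elim UnionE)
      obtain h where h: "homeomorphic_maps (subtopology Y V) (subtopology X U) p h"
        using bspec [OF \<V>(3) V(1)] homeomorphic_map_maps by blast
      have "continuous_map (top_of_set {a..b}) X \<alpha>"
        using ab01
        by (intro continuous_map_from_subtopology_mono [OF \<alpha> [unfolded pathin_def]]) auto
      then have "continuous_map (top_of_set {a..b}) (subtopology X U) \<alpha>"
        using \<alpha>U by (auto simp: continuous_map_in_subtopology)
      moreover have "continuous_map (subtopology X U) Y h"
        using h by (simp add: homeomorphic_maps_def continuous_map_in_subtopology)
      ultimately have "continuous_map (top_of_set {a..b}) Y (h \<circ> \<alpha>)"
        by (rule continuous_map_compose)
      moreover have "(h \<circ> \<alpha>) a = y"
        using h y V(2) by (auto simp: homeomorphic_maps_def simp flip: y(2))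
      moreover have "p ((h \<circ> \<alpha>) t) = \<alpha> t" if "t \<in> {a..b}" for t
        using h \<alpha>U [OF that] openin_subset [OF U(1)] by (auto simp: homeomorphic_maps_def)
      ultimately show "\<exists>g. continuous_map (top_of_set {a..b}) Y g \<and> g a = y \<and> (\<forall>t\<in>{a..b}. p (g t) = \<alpha> t)"
        by blast
    qed
    then show ?case
      using d(1) by blast
  qed
  then show ?thesis
    using y \<alpha>0 by (simp add: P_def pathin_def)
qed

lemma covering_map_imp_semicovering_map:
  assumes cov: "covering_map Y X p"
  shows "semicovering_map Y X p"
proof -
  have p: "local_homeomorphism Y X p"
    using cov by (rule covering_map_imp_local_homeomorphism)
  have "continuous_lifting_of_paths Y X p"
  proof (rule continuous_lifting_of_pathsI [OF p])
    show "\<exists>g. pathin Y g \<and> g 0 = y \<and> (\<forall>t \<in> {0..1}. p (g t) = \<alpha> t)"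
      if "pathin X \<alpha>" "y \<in> topspace Y" "\<alpha> 0 = p y" for \<alpha> y
      using covering_map_path_lift_exists [OF cov] that .
    show "g t = h t" if "pathin Y g" "pathin Y h" "g 0 = h 0"
      "\<forall>t \<in> {0..1}. p (g t) = p (h t)" "t \<in> {0..1}" for g h t
      using covering_map_path_lift_unique [OF cov that(1-3) _ that(5)] that(4) by blast
  qed
  then show ?thesis
    using p continuous_lifting_of_homotopies_if_paths by (simp add: semicovering_map_def)
qed

section \<open>Semicoverings of semilocally 1-connected spaces are coverings\<close>

lemma local_homeomorphism_locally_path_connected_space:
  assumes p: "local_homeomorphism Y X p" and X: "locally_path_connected_space X"
  shows "locally_path_connected_space Y"
  unfolding locally_path_connected_space
proof (intro allI impI)
  fix W y assume W: "openin Y W \<and> y \<in> W"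
  then have "y \<in> topspace Y"
    using openin_subset by blast
  then obtain V where V: "openin Y V" "y \<in> V" "openin X (p ` V)"
    "homeomorphic_map (subtopology Y V) (subtopology X (p ` V)) p"
    using p unfolding local_homeomorphism_def by blast
  have "locally_path_connected_space (subtopology X (p ` V))"
    using locally_path_connected_space_open_subset [OF X V(3)] .
  then have "locally_path_connected_space (subtopology Y V)"
    using homeomorphic_locally_path_connected_space homeomorphic_map_imp_homeomorphic_space [OF V(4)]
    by blast
  moreover have "openin (subtopology Y V) (W \<inter> V)" "y \<in> W \<inter> V"
    using W V by (simp_all add: openin_subtopology_Int)
  ultimately obtain U where U: "openin (subtopology Y V) U" "path_connectedin (subtopology Y V) U"
    "y \<in> U" "U \<subseteq> W \<inter> V"
    unfolding locally_path_connected_space by blast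
  have "openin Y U" "path_connectedin Y U"
    using U(1,2) V(1) openin_trans_full path_connectedin_subtopology by blast+
  then show "\<exists>U. openin Y U \<and> path_connectedin Y U \<and> y \<in> U \<and> U \<subseteq> W"
    using U by blast
qed

text \<open>This translates the triviality of the induced map of fundamental groups, which concerns classes
  of loops, into a statement on individual loops.\<close>

lemma loop_null_homotopic_if_pi1_map_trivial:
  assumes triv: "\<forall>A \<in> carrier (pi1 (subtopology X U) x). pi1_map X x (\<lambda>u. u) A = \<one>\<^bsub>pi1 X x\<^esub>"
    and \<gamma>: "\<gamma> \<in> loops (subtopology X U) x"
  shows "path_homotopic X (\<lambda>t. x) \<gamma>"
proof -
  have \<gamma>c: "continuous_map (top_of_set {0..1}) (subtopology X U) \<gamma>"
    using \<gamma> by (simp add: loops_def pathin_def)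
  then have \<gamma>X: "\<gamma> \<in> loops X x"
    using \<gamma> by (simp add: loops_def pathin_def continuous_map_in_subtopology)
  define A where "A = loop_homotopy (subtopology X U) x `` {\<gamma>}"
  have "A \<in> carrier (pi1 (subtopology X U) x)"
    using \<gamma> by (simp add: pi1_def A_def quotientI)
  then have "loop_homotopy X x `` {(\<lambda>u. u) \<circ> g | g. g \<in> A} = loop_homotopy X x `` {\<lambda>t. x}"
    using triv by (simp add: pi1_map_def pi1_def)
  moreover have "\<gamma> \<in> A"
    using \<gamma> \<gamma>c by (simp add: A_def loop_homotopy_def path_homotopic_def)
  moreover have "(\<gamma>, \<gamma>) \<in> loop_homotopy X x"
    using \<gamma>X by (simp add: loop_homotopy_def path_homotopic_def loops_def pathin_def)
  ultimately have "\<gamma> \<in> loop_homotopy X x `` {\<lambda>t. x}"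
    by (metis (mono_tags, lifting) Image_iff fun.map_ident mem_Collect_eq)
  then show ?thesis
    by (simp add: loop_homotopy_def)
qed

lemma pathin_reverse:
  assumes "pathin X g"
  shows "pathin X (\<lambda>t. g (1 - t))"
proof -
  have "continuous_map (top_of_set {0..1}) (top_of_set {0..1::real}) (\<lambda>t. 1 - t)"
    by (auto simp: continuous_on_op_minus)
  from continuous_map_compose [OF this] show ?thesis
    using assms by (fastforce simp: pathin_def o_def)
qed

text \<open>Let \<open>U\<close> be an open path connected neighborhood of \<open>x\<close> whose loops at \<open>x\<close> are null homotopic in \<open>X\<close>.
  The sheets over \<open>U\<close> are the path components of \<open>p\<inverse>(U)\<close>. They are open since \<open>Y\<close> is locally
  path connected. Lifts of paths in \<open>U\<close> show that each of them maps onto \<open>U\<close>. For injectivity, let \<open>w\<close>, \<open>w'\<close>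
  lie over the same point in one component, and lift a path in \<open>U\<close> from their image to \<open>x\<close> at both.
  The two endpoints are joined within \<open>p\<inverse>(U)\<close> by a path over a loop in \<open>U\<close> at \<open>x\<close>; as this loop is
  null homotopic in \<open>X\<close>, the endpoints coincide, and then so do \<open>w\<close> and \<open>w'\<close>.\<close>

lemma semicovering_map_imp_covering_map:
  assumes X: "locally_path_connected_space X" "semilocally_1_connected X"
    and semi: "semicovering_map Y X p"
  shows "covering_map Y X p"
  unfolding covering_map_def
proof (intro conjI ballI)
  have p: "local_homeomorphism Y X p" and lift: "continuous_lifting_of_paths Y X p"
    using semi by (simp_all add: semicovering_map_def)
  show pc: "continuous_map Y X p"
    using p by (simp add: local_homeomorphism_def)
  fix x assume "x \<in> topspace X"
  then obtain N where xN: "x \<in> X interior_of N"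
    and triv: "\<forall>A \<in> carrier (pi1 (subtopology X N) x). pi1_map X x (\<lambda>u. u) A = \<one>\<^bsub>pi1 X x\<^esub>"
    using X(2) unfolding semilocally_1_connected_def by blast
  obtain U where U: "openin X U" "path_connectedin X U" "x \<in> U" "U \<subseteq> X interior_of N"
    using X(1) xN openin_interior_of unfolding locally_path_connected_space by metis
  have UN: "U \<subseteq> N"
    using order_trans [OF U(4) interior_of_subset] .
  define E where "E = {y \<in> topspace Y. p y \<in> U}"
  define \<V> where "\<V> = path_components_of (subtopology Y E)"
  have E: "openin Y E"
    unfolding E_def using openin_continuous_map_preimage [OF pc U(1)] .
  have topE: "topspace (subtopology Y E) = E"
    by (rule topspace_subtopology_subset [OF openin_subset [OF E]])
  have "\<Union>\<V> = E"
    using Union_path_components_of [of "subtopology Y E"] unfolding \<V>_def topE .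
  moreover have \<V>_open: "openin Y V" if "V \<in> \<V>" for V
    using local_homeomorphism_locally_path_connected_space [OF p X(1)] E that
    unfolding \<V>_def locally_path_connected_space_open_path_components by blast
  moreover have "pairwise disjnt \<V>"
    by (simp add: \<V>_def pairwise_disjoint_path_components_of)
  moreover have "homeomorphic_map (subtopology Y V) (subtopology X U) p" if V: "V \<in> \<V>" for V
  proof -
    obtain a where Va: "V = Collect (path_component_of (subtopology Y E) a)"
      using V unfolding \<V>_def path_components_of_def by (elim imageE)
    have path_component: "path_component_of (subtopology Y E) v w" if "v \<in> V" "w \<in> V" for v w
      using that unfolding Va mem_Collect_eq
      by (rule path_component_of_trans [OF path_component_of_sym])
    have in_V: "w \<in> V" if "v \<in> V" "path_component_of (subtopology Y E) v w" for v w
      using that unfolding Va mem_Collect_eq by (rule path_component_of_trans)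
    have VE: "V \<subseteq> E"
      using path_components_of_subset [of V "subtopology Y E"] V by (simp add: \<V>_def topE)
    have pU: "p v \<in> U" if "v \<in> V" for v
      using VE that by (auto simp: E_def)
    have top: "topspace (subtopology Y V) = V" "topspace (subtopology X U) = U"
      using openin_subset [OF \<V>_open [OF V]] openin_subset [OF U(1)]
        by (auto simp: Int_absorb1)
    have lift_in_E: "\<exists>g. pathin (subtopology Y E) g \<and> g 0 = w \<and> (\<forall>t \<in> {0..1}. p (g t) = \<delta> t)"
      if w: "w \<in> V" and \<delta>: "pathin (subtopology X U) \<delta>" "\<delta> 0 = p w" for w \<delta>
    proof -
      have "pathin X \<delta>"
        using \<delta> by (simp add: pathin_def continuous_map_in_subtopology)
      moreover have "w \<in> topspace Y"
        using w VE by (auto simp: E_def)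
      ultimately have "\<exists>g. pathin Y g \<and> g 0 = w \<and> (\<forall>t \<in> {0..1}. p (g t) = \<delta> t)"
        using \<delta>(2) by (rule path_lift_exists [OF lift])
      then obtain g where g: "pathin Y g" "g 0 = w" "\<forall>t \<in> {0..1}. p (g t) = \<delta> t"
        by blast
      have "g t \<in> E" if "t \<in> {0..1}" for t
        using pathin_in_topspace [OF g(1) that] bspec [OF g(3) that] pathin_in_topspace [OF \<delta>(1) that] top
        by (simp add: E_def)
      then have "pathin (subtopology Y E) g"
        using g(1) by (auto simp: pathin_def continuous_map_in_subtopology)
      then show ?thesis
        using g by blast
    qed
    have U_path: "\<exists>\<delta>. pathin (subtopology X U) \<delta> \<and> \<delta> 0 = u \<and> \<delta> 1 = v" if "u \<in> U" "v \<in> U" for u v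
      using U(2) that top unfolding path_connectedin_def path_connected_space_def by simp
    show ?thesis
    proof (rule bijective_open_imp_homeomorphic_map)
      show "continuous_map (subtopology Y V) (subtopology X U) p"
        using continuous_map_from_subtopology [OF pc] VE
        by (auto simp: continuous_map_in_subtopology E_def)
      show "open_map (subtopology Y V) (subtopology X U) p"
        unfolding open_map_def
      proof (intro allI impI)
        fix S assume S: "openin (subtopology Y V) S"
        then have "openin Y S" "S \<subseteq> V"
          using \<V>_open [OF V] openin_trans_full openin_subset top by blast+
        then have "openin X (p ` S)" "p ` S \<subseteq> U"
          using local_homeomorphism_imp_open_map [OF p] VE by (auto simp: open_map_def E_def)
        then show "openin (subtopology X U) (p ` S)"
          using U(1) openin_open_subtopology by blast
      qed
      show "p ` topspace (subtopology Y V) = topspace (subtopology X U)"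
        unfolding top
      proof
        show "p ` V \<subseteq> U"
          using VE by (auto simp: E_def)
        show "U \<subseteq> p ` V"
        proof
          fix u assume u: "u \<in> U"
          obtain v where v: "v \<in> V"
            using nonempty_path_components_of V unfolding \<V>_def by blast
          then obtain \<delta> where \<delta>: "pathin (subtopology X U) \<delta>" "\<delta> 0 = p v" "\<delta> 1 = u"
            using U_path [OF pU u] by blast
          obtain g where g: "pathin (subtopology Y E) g" "g 0 = v" "\<forall>t \<in> {0..1}. p (g t) = \<delta> t"
            using lift_in_E [OF v \<delta>(1,2)] by blast
          have "g 1 \<in> V"
            using in_V [OF v] g path_component_of_def by metis
          moreover have "p (g 1) = u"
            using g(3) \<delta>(3) by simp
          ultimately show "u \<in> p ` V"
            by blast
        qed
      qed
      show "inj_on p (topspace (subtopology Y V))"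
        unfolding top
      proof (rule inj_onI)
        fix w w' assume w: "w \<in> V" and w': "w' \<in> V" and eq: "p w = p w'"
        obtain \<delta> where \<delta>: "pathin (subtopology X U) \<delta>" "\<delta> 0 = p w" "\<delta> 1 = x"
          using U_path [OF pU [OF w] U(3)] by blast
        obtain d where d: "pathin (subtopology Y E) d" "d 0 = w" "\<And>t. t \<in> {0..1} \<Longrightarrow> p (d t) = \<delta> t"
          using lift_in_E [OF w \<delta>(1,2)] by blast
        obtain d' where d': "pathin (subtopology Y E) d'" "d' 0 = w'" "\<And>t. t \<in> {0..1} \<Longrightarrow> p (d' t) = \<delta> t"
          using lift_in_E [OF w' \<delta>(1)] \<delta>(2) eq by auto
        have "d 1 \<in> V" "d' 1 \<in> V"
          using in_V [OF w] in_V [OF w'] d(1,2) d'(1,2) path_component_of_def by metis+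
        then obtain g where g: "pathin (subtopology Y E) g" "g 0 = d 1" "g 1 = d' 1"
          using path_component path_component_of_def by metis
        have ends: "p (g 0) = x" "p (g 1) = x"
          using g d(3) [of 1] d'(3) [of 1] \<delta>(3) by simp_all
        have gY: "pathin Y g" and gE: "\<And>t. t \<in> {0..1} \<Longrightarrow> g t \<in> E"
          using g(1) by (auto simp: pathin_def continuous_map_in_subtopology)
        have "pathin X (p \<circ> g)"
          using pathin_compose [OF gY pc] .
        then have "p \<circ> g \<in> loops (subtopology X N) x"
          using ends gE UN by (auto simp: loops_def pathin_def continuous_map_in_subtopology E_def)
        then have "path_homotopic X (\<lambda>t. x) (p \<circ> g)"
          by (rule loop_null_homotopic_if_pi1_map_trivial [OF triv])
        then have closed: "d 1 = d' 1"
          using lift_of_null_homotopic_loop_is_closed [OF lift gY] ends g by simp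
        have "pathin Y d" "pathin Y d'"
          using d(1) d'(1) by (simp_all add: pathin_def continuous_map_in_subtopology)
        \<comment> \<open>Read backwards, \<open>d\<close> and \<open>d'\<close> lift the same path from the same point.\<close>
        then have "d (1 - 1) = d' (1 - 1)"
          using closed d(3) d'(3)
          by (intro path_lift_unique [OF lift pathin_reverse pathin_reverse, of d d' 1]) auto
        then show "w = w'"
          using d(2) d'(2) by simp
      qed
    qed
  qed
  ultimately show "\<exists>U. openin X U \<and> x \<in> U \<and>
      (\<exists>\<V>. \<Union>\<V> = {y \<in> topspace Y. p y \<in> U} \<and> (\<forall>V\<in>\<V>. openin Y V) \<and> pairwise disjnt \<V> \<and>
        (\<forall>V\<in>\<V>. homeomorphic_map (subtopology Y V) (subtopology X U) p))"
    using U(1,3) unfolding E_def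
    by (intro exI [of _ U] exI [of _ \<V>] conjI ballI) simp_all
qed

theorem corollary7p2:
  fixes X :: "'a topology"
  assumes "path_connected_space X"
    and "locally_path_connected_space X"
    and "semilocally_1_connected X"
  shows "(Cov X :: ('b topology \<times> ('b \<Rightarrow> 'a), 'b \<Rightarrow> 'b) cat) = SCov X
       \<and> (Cov0 X :: ('b topology \<times> ('b \<Rightarrow> 'a), 'b \<Rightarrow> 'b) cat) = SCov0 X"
proof -
  have "covering_map Y X p \<longleftrightarrow> semicovering_map Y X p" for Y :: "'b topology" and p
    using covering_map_imp_semicovering_map semicovering_map_imp_covering_map assms(2,3) by blast
  then have "(Cov X :: ('b topology \<times> ('b \<Rightarrow> 'a), 'b \<Rightarrow> 'b) cat) = SCov X"
    by (simp add: Cov_def SCov_def)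
  then show ?thesis
    by (simp add: Cov0_def SCov0_def)
qed

end
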